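(* Let $\mathbb{K}$ be a field of characteristic $3$. Then the elements $A(x,y)=-[x,y]$ and $B(x,y)=[x,y]$ of the free Lie algebra $\mathfrak{lie}_2$ over $\mathbb{K}$ on $x,y$ satisfy $$[x,A]+[y,B]=x^3+y^3-(x+y)^3,\qquad \tilde{\mathrm{tr}}(x\,\partial_xA+y\,\partial_yB)=\tfrac12\,\tilde{\mathrm{tr}}\bigl(x^{2}+y^{2}-(x+y)^{2}\bigr),$$ and the element $\psi(x,y)=-[x,y]$, which satisfies $\psi(-x-y,x)=A(x,y)$ and $\psi(-x-y,y)=B(x,y)$, belongs to the Grothendieck--Teichmüller Lie algebra $\mathfrak{grt}$ over $\mathbb{K}$.
   Context: $\mathfrak{lie}_2$ is the (degree-completed) free Lie algebra over $\mathbb{K}$ on $x,y$, regarded as a subspace of the (degree-completed) free unital associative algebra $\mathrm{Assoc}_2$ on $x,y$ (its universal enveloping algebra). Every $a\in\mathrm{Assoc}_2$ is uniquely $a=a_0+a_1x+a_2y$ with $a_0\in\mathbb{K}$, $a_1,a_2\in\mathrm{Assoc}_2$; put $\partial_xa=a_1$, $\partial_ya=a_2$. The map $\tilde{\mathrm{tr}}$ is the natural projection to $\mathfrak{tr}_2=\mathrm{Assoc}_2^+/\langle ab-ba: a,b\in\mathrm{Assoc}_2\rangle$, where $\mathrm{Assoc}_2^+$ is the positive-degree part and one quotients by the subspace spanned by commutators. The Lie algebra $\mathfrak{t}_n$ is the quotient of the free Lie algebra over $\mathbb{K}$ with $n(n-1)/2$ generators $t^{i,j}=t^{j,i}$ ($1\le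 i\neq j\le n$) by the relations $[t^{i,j},t^{k,l}]=0$ if $i,j,k,l$ are all distinct, and $[t^{i,j}+t^{i,k},t^{j,k}]=0$ for all triples of distinct indices $i,j,k$. Put $t^{i,jk}=t^{i,j}+t^{i,k}$ and $t^{ij,k}=t^{i,k}+t^{j,k}$. $\mathfrak{grt}$ over $\mathbb{K}$ is spanned by the elements $\psi\in\mathfrak{lie}_2$ satisfying: (i) $\psi(x,y)=-\psi(y,x)$; (ii) $\psi(x,y)+\psi(y,z)+\psi(z,x)=0$ where $z=-x-y$; (iii) $\psi(t^{1,2},t^{2,34})+\psi(t^{12,3},t^{3,4})=\psi(t^{2,3},t^{3,4})+\psi(t^{1,23},t^{23,4})+\psi(t^{1,2},t^{2,3})$ in $\mathfrak{t}_4$ (degree-completed when $\psi$ is an infinite series), where $t^{2,34}=t^{2,3}+t^{2,4}$, $t^{12,3}=t^{1,3}+t^{2,3}$, $t^{1,23}=t^{1,2}+t^{1,3}$, $t^{23,4}=t^{2,4}+t^{3,4}$. Here $\psi(u,v)$ denotes the image of $\psi$ under the Lie algebra homomorphism sending $x\mapsto u$, $y\mapsto v$. *)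

theory Defs
  imports Complex_Main "HOL-Library.Set_Algebras"
begin

section \<open>Degree-completed free associative algebras\<close>

text \<open>
  The degree-completed free unital associative algebra on a set of letters: formal
  noncommutative power series, that is, arbitrary functions from words to scalars.
\<close>

typedef ('v, 'k) ncseries = "UNIV :: ('v list \<Rightarrow> 'k) set"
  morphisms coeff Series ..

setup_lifting type_definition_ncseries

lemma ncseries_eqI: "(\<And>w. coeff a w = coeff b w) \<Longrightarrow> a = b"
  by transfer auto

instantiation ncseries :: (type, comm_ring_1) ring_1
begin

lift_definition zero_ncseries :: "('a, 'b) ncseries" is "\<lambda>_. 0" .

lift_definition one_ncseries :: "('a, 'b) ncseries" is "\<lambda>w. if w = [] then 1 else 0" .

lift_definition plus_ncseries :: "('a, 'b) ncseries \<Rightarrow> ('a, 'b) ncseries \<Rightarrow> ('a, 'b) ncseries"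
  is "\<lambda>f g w. f w + g w" .

lift_definition minus_ncseries :: "('a, 'b) ncseries \<Rightarrow> ('a, 'b) ncseries \<Rightarrow> ('a, 'b) ncseries"
  is "\<lambda>f g w. f w - g w" .

lift_definition uminus_ncseries :: "('a, 'b) ncseries \<Rightarrow> ('a, 'b) ncseries"
  is "\<lambda>f w. - f w" .

lift_definition times_ncseries :: "('a, 'b) ncseries \<Rightarrow> ('a, 'b) ncseries \<Rightarrow> ('a, 'b) ncseries"
  is "\<lambda>f g w. \<Sum>i\<le>length w. f (take i w) * g (drop i w)" .

instance
proof
  fix a b c :: "('a, 'b) ncseries"
  show "a * b * c = a * (b * c)"
  proof (transfer, rule ext)
    fix f g h :: "'a list \<Rightarrow> 'b" and w :: "'a list"
    let ?n = "length w"
    let ?t = "\<lambda>i j. f (take i w) * g (drop i (take j w)) * h (drop j w)"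
    have "(\<Sum>j\<le>?n. (\<Sum>i\<le>length (take j w). f (take i (take j w)) * g (drop i (take j w)))
              * h (drop j w))
        = (\<Sum>j\<le>?n. \<Sum>i\<le>j. ?t i j)"
      by (intro sum.cong refl) (auto simp: sum_distrib_right min_def)
    also have "\<dots> = (\<Sum>i\<le>?n. \<Sum>j\<in>{i..?n}. ?t i j)"
      unfolding sum.Sigma[OF finite_atMost ballI[OF finite_atMost]]
                sum.Sigma[OF finite_atMost ballI[OF finite_atLeastAtMost]]
      by (rule sum.reindex_bij_witness[where i = "\<lambda>(i, j). (j, i)" and j = "\<lambda>(j, i). (i, j)"]) auto
    also have "\<dots> = (\<Sum>i\<le>?n. f (take i w) *
        (\<Sum>k\<le>length (drop i w). g (take k (drop i w)) * h (drop k (drop i w))))"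
    proof (rule sum.cong[OF refl])
      fix i assume i: "i \<in> {..?n}"
      have "(\<Sum>j\<in>{i..?n}. ?t i j) = (\<Sum>k\<le>?n - i. ?t i (k + i))"
        using i by (intro sum.reindex_bij_witness[where i = "\<lambda>k. k + i" and j = "\<lambda>j. j - i"]) auto
      also have "\<dots> = f (take i w) *
        (\<Sum>k\<le>length (drop i w). g (take k (drop i w)) * h (drop k (drop i w)))"
        by (simp add: sum_distrib_left mult.assoc drop_take)
      finally show "(\<Sum>j\<in>{i..?n}. ?t i j) = f (take i w) *
        (\<Sum>k\<le>length (drop i w). g (take k (drop i w)) * h (drop k (drop i w)))" .
    qed
    finally show "(\<Sum>j\<le>?n. (\<Sum>i\<le>length (take j w). f (take i (take j w)) * g (drop i (take j w)))
              * h (drop j w)) = (\<Sum>i\<le>?n. f (take i w) *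
        (\<Sum>k\<le>length (drop i w). g (take k (drop i w)) * h (drop k (drop i w))))" .
  qed
  show "1 * a = a"
  proof (transfer, rule ext)
    fix f :: "'a list \<Rightarrow> 'b" and w :: "'a list"
    have "(\<Sum>i\<le>length w. (if take i w = [] then 1 else 0) * f (drop i w))
        = (\<Sum>i\<le>length w. if i = 0 then f (drop i w) else 0)"
      by (intro sum.cong refl) auto
    then show "(\<Sum>i\<le>length w. (if take i w = [] then 1 else 0) * f (drop i w)) = f w"
      by simp
  qed
  show "a * 1 = a"
  proof (transfer, rule ext)
    fix f :: "'a list \<Rightarrow> 'b" and w :: "'a list"
    have "(\<Sum>i\<le>length w. f (take i w) * (if drop i w = [] then 1 else 0))
        = (\<Sum>i\<le>length w. if i = length w then f (take i w) else 0)"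
      by (intro sum.cong refl) auto
    then show "(\<Sum>i\<le>length w. f (take i w) * (if drop i w = [] then 1 else 0)) = f w"
      by simp
  qed
  show "(a + b) * c = a * c + b * c"
    by transfer (simp add: fun_eq_iff distrib_right sum.distrib)
  show "a * (b + c) = a * b + a * c"
    by transfer (simp add: fun_eq_iff distrib_left sum.distrib)
  show "a + b + c = a + (b + c)"
    by transfer (simp add: fun_eq_iff add.assoc)
  show "a + b = b + a"
    by transfer (simp add: fun_eq_iff add.commute)
  show "0 + a = a" "- a + a = 0" "a - b = a + - b"
    by (transfer; simp)+
  show "(0 :: ('a, 'b) ncseries) \<noteq> 1"
    by transfer (simp add: fun_eq_iff)
qed

end

lift_definition scale :: "'k::comm_ring_1 \<Rightarrow> ('v, 'k) ncseries \<Rightarrow> ('v, 'k) ncseries"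
  is "\<lambda>c f w. c * f w" .

lift_definition var :: "'v \<Rightarrow> ('v, 'k::comm_ring_1) ncseries"
  is "\<lambda>v w. if w = [v] then 1 else 0" .

lift_definition homog_part :: "nat \<Rightarrow> ('v, 'k::comm_ring_1) ncseries \<Rightarrow> ('v, 'k) ncseries"
  is "\<lambda>d f w. if length w = d then f w else 0" .

global_interpretation ncseries: vector_space "scale :: 'k::field \<Rightarrow> ('v, 'k) ncseries \<Rightarrow> _"
  by unfold_locales (transfer; simp add: fun_eq_iff algebra_simps)+

definition bracket :: "('v, 'k::comm_ring_1) ncseries \<Rightarrow> ('v, 'k) ncseries \<Rightarrow> ('v, 'k) ncseries"
  where "bracket a b = a * b - b * a"


section \<open>Free Lie algebras\<close>

text \<open>
  The free Lie algebra on a set of letters, realised inside its universal enveloping algebra,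
  the free associative algebra, as the Lie subalgebra generated by the letters. (By the
  theorems of Magnus and Witt this subalgebra is free over any field, whatever the characteristic.)
\<close>

inductive_set free_lie :: "'v set \<Rightarrow> ('v, 'k::field) ncseries set" for G where
  zero: "0 \<in> free_lie G"
| var: "g \<in> G \<Longrightarrow> var g \<in> free_lie G"
| add: "a \<in> free_lie G \<Longrightarrow> b \<in> free_lie G \<Longrightarrow> a + b \<in> free_lie G"
| scale: "a \<in> free_lie G \<Longrightarrow> scale c a \<in> free_lie G"
| bracket: "a \<in> free_lie G \<Longrightarrow> b \<in> free_lie G \<Longrightarrow> bracket a b \<in> free_lie G"

text \<open>
  The degree completion of a graded subspace \<open>V\<close>: the series all of whose homogeneous
  components lie in \<open>V\<close>.
\<close>

definition degree_completion :: "('v, 'k::field) ncseries set \<Rightarrow> ('v, 'k) ncseries set"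
  where "degree_completion V = {a. \<forall>d. homog_part d a \<in> V}"


section \<open>The two-generator case\<close>

datatype letter = X | Y

instance letter :: finite
proof
  have "(UNIV :: letter set) \<subseteq> {X, Y}"
    using letter.exhaust by blast
  then show "finite (UNIV :: letter set)"
    by (rule finite_subset) simp
qed

type_synonym 'k assoc2 = "(letter, 'k) ncseries"

definition lie2 :: "'k::field assoc2 set"
  where "lie2 = degree_completion (free_lie UNIV)"

lemma right_decomposition:
  fixes a :: "'k::field assoc2"
  shows "\<exists>!(a0, a1, a2). a = scale a0 1 + a1 * var X + a2 * var Y"
proof -
  have mult_var: "coeff (b * var v) w = (if w \<noteq> [] \<and> last w = v then coeff b (butlast w) else 0)"
    for b :: "'k assoc2" and v w
  proof (transfer fixing: v w)
    fix f :: "letter list \<Rightarrow> 'k"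
    show "(\<Sum>i\<le>length w. f (take i w) * (if drop i w = [v] then 1 else 0))
        = (if w \<noteq> [] \<and> last w = v then f (butlast w) else 0)"
    proof (cases w rule: rev_cases)
      case Nil
      then show ?thesis by simp
    next
      case (snoc u l)
      have "(drop i w = [v]) = (i = length u \<and> l = v)" if "i \<le> length w" for i
      proof
        assume d: "drop i w = [v]"
        then have "length (drop i w) = 1" by simp
        then have "i = length u" using snoc by simp
        then show "i = length u \<and> l = v" using d snoc by simp
      qed (use snoc in auto)
      then have "(\<Sum>i\<le>length w. f (take i w) * (if drop i w = [v] then 1 else 0))
          = (\<Sum>i\<le>length w. if i = length u then (if l = v then f (take i w) else 0) else 0)"
        by (intro sum.cong refl) auto
      then show ?thesis using snoc by simp
    qed
  qed
  have const: "coeff (scale c 1 :: 'k assoc2) w = (if w = [] then c else 0)" for c w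
    by transfer simp
  have plus: "coeff (b + c) w = coeff b w + coeff c w" for b c :: "'k assoc2" and w
    by transfer simp
  have iff: "a = scale a0 1 + a1 * var X + a2 * var Y \<longleftrightarrow>
      a0 = coeff a [] \<and> a1 = Series (\<lambda>u. coeff a (u @ [X])) \<and> a2 = Series (\<lambda>u. coeff a (u @ [Y]))"
    (is "?L \<longleftrightarrow> ?R") for a0 a1 a2
  proof
    assume L: ?L
    have c: "coeff a w = coeff (scale a0 1 + a1 * var X + a2 * var Y) w" for w
      using L by simp
    show ?R
      using c[of "[]"] by (auto intro!: ncseries_eqI simp: Series_inverse c plus mult_var const)
  next
    assume R: ?R
    show ?L
    proof (rule ncseries_eqI)
      fix w :: "letter list"
      show "coeff a w = coeff (scale a0 1 + a1 * var X + a2 * var Y) w"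
      proof (cases w rule: rev_cases)
        case Nil
        then show ?thesis using R by (simp add: plus mult_var const)
      next
        case (snoc u l)
        then show ?thesis
          using R by (cases l) (simp_all add: plus mult_var const Series_inverse)
      qed
    qed
  qed
  show ?thesis
    by (rule ex1I[of _ "(coeff a [], Series (\<lambda>u. coeff a (u @ [X])), Series (\<lambda>u. coeff a (u @ [Y])))"])
       (auto simp: iff)
qed

definition partial_X :: "'k::field assoc2 \<Rightarrow> 'k assoc2"
  where "partial_X a = (THE a1. \<exists>a0 a2. a = scale a0 1 + a1 * var X + a2 * var Y)"

definition partial_Y :: "'k::field assoc2 \<Rightarrow> 'k assoc2"
  where "partial_Y a = (THE a2. \<exists>a0 a1. a = scale a0 1 + a1 * var X + a2 * var Y)"

text \<open>
  Elements of a quotient by a subspace \<open>W\<close> are cosets \<open>a +o W\<close>; they are added with the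
  pointwise addition of sets and multiplied by scalars as follows (adding \<open>W\<close> again only matters
  for the scalar 0).
\<close>

definition coset_scale ::
  "('v, 'k::field) ncseries set \<Rightarrow> 'k \<Rightarrow> ('v, 'k) ncseries set \<Rightarrow> ('v, 'k) ncseries set"
  where "coset_scale W c C = scale c ` C + W"

definition commutator_span :: "'k::field assoc2 set"
  where "commutator_span = ncseries.span {a * b - b * a | a b. True}"

lemma commutator_span_no_constant: "a \<in> commutator_span \<Longrightarrow> coeff a [] = 0"
proof -
  have "ncseries.subspace {a :: 'a assoc2. coeff a [] = 0}"
    unfolding ncseries.subspace_def by (auto; transfer; simp)
  moreover have "coeff (a * b - b * a) [] = 0" for a b :: "'a assoc2"
    by transfer (simp add: mult.commute)
  ultimately have "commutator_span \<subseteq> {a :: 'a assoc2. coeff a [] = 0}"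
    unfolding commutator_span_def by (intro ncseries.span_minimal) auto
  then show "a \<in> commutator_span \<Longrightarrow> coeff a [] = 0" by blast
qed

text \<open>
  Commutators have no constant term, so for \<open>a\<close> without constant term \<open>tr a\<close> is the class of
  \<open>a\<close> in the quotient of the positive-degree part.
\<close>

definition tr :: "'k::field assoc2 \<Rightarrow> 'k assoc2 set"
  where "tr a = a +o commutator_span"

definition tr_scale :: "'k::field \<Rightarrow> 'k assoc2 set \<Rightarrow> 'k assoc2 set"
  where "tr_scale = coset_scale commutator_span"


section \<open>Substitution\<close>

definition word_subst ::
  "('v, 'k::comm_ring_1) ncseries \<Rightarrow> ('v, 'k) ncseries \<Rightarrow> letter list \<Rightarrow> ('v, 'k) ncseries"
  where "word_subst u v m = prod_list (map (\<lambda>l. case l of X \<Rightarrow> u | Y \<Rightarrow> v) m)"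

text \<open>
  The value \<open>a(u, v)\<close> for series \<open>u\<close>, \<open>v\<close> without constant term: a word \<open>m\<close> then only
  contributes to coefficients of words at least as long as \<open>m\<close>, which makes the sums finite.
\<close>

definition subst2 ::
  "'k::comm_ring_1 assoc2 \<Rightarrow> ('v, 'k) ncseries \<Rightarrow> ('v, 'k) ncseries \<Rightarrow> ('v, 'k) ncseries"
  where "subst2 a u v =
    Series (\<lambda>w. \<Sum>m | length m \<le> length w. coeff a m * coeff (word_subst u v m) w)"

lemma coeff_simps:
  "coeff 0 w = 0" "coeff (a + b) w = coeff a w + coeff b w" "coeff (- a) w = - coeff a w"
  "coeff (a - b) w = coeff a w - coeff b w" "coeff (scale c a) w = c * coeff a w"
  "coeff (var v) w = (if w = [v] then 1 else 0)" "coeff 1 w = (if w = [] then 1 else 0)"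
  by (transfer; simp)+

lemma coeff_mult: "coeff (a * b) w = (\<Sum>i\<le>length w. coeff a (take i w) * coeff b (drop i w))"
  by transfer simp

lemma finite_words: "finite {m :: letter list. length m \<le> n}"
  using finite_lists_length_le[of "UNIV :: letter set" n] by simp

lemma coeff_subst2:
  "coeff (subst2 a u v) w = (\<Sum>m | length m \<le> length w. coeff a m * coeff (word_subst u v m) w)"
  by (simp add: subst2_def Series_inverse)

lemma word_subst_append: "word_subst u v (m @ m') = word_subst u v m * word_subst u v m'"
  by (simp add: word_subst_def)

lemma coeff_word_subst_eq_0:
  assumes "coeff u [] = 0" "coeff v [] = 0"
  shows "length w < length m \<Longrightarrow> coeff (word_subst u v m) w = 0"
proof (induction m arbitrary: w)
  case Nil
  then show ?case by simp
next
  case (Cons l m)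
  let ?p = "case l of X \<Rightarrow> u | Y \<Rightarrow> v"
  have "coeff ?p (take i w) * coeff (word_subst u v m) (drop i w) = 0" if "i \<le> length w" for i
  proof (cases "i = 0")
    case True
    then show ?thesis using assms by (cases l) simp_all
  next
    case False
    then have "length (drop i w) < length m" using that Cons.prems by auto
    then show ?thesis using Cons.IH by simp
  qed
  moreover have "word_subst u v (l # m) = ?p * word_subst u v m"
    by (simp add: word_subst_def)
  ultimately show ?case by (simp add: coeff_mult)
qed

lemma coeff_subst2':
  assumes "coeff u [] = 0" "coeff v [] = 0" "length w \<le> N"
  shows "coeff (subst2 a u v) w = (\<Sum>m | length m \<le> N. coeff a m * coeff (word_subst u v m) w)"
  unfolding coeff_subst2 using assms
  by (intro sum.mono_neutral_left finite_words) (auto simp: coeff_word_subst_eq_0)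

text \<open>Substitution is the homomorphism of unital algebras determined by \<open>X \<mapsto> u\<close>, \<open>Y \<mapsto> v\<close>.\<close>

lemma subst2_add: "subst2 (a + b) u v = subst2 a u v + subst2 b u v"
  by (rule ncseries_eqI) (simp add: coeff_subst2 coeff_simps distrib_right sum.distrib)

lemma subst2_scale: "subst2 (scale c a) u v = scale c (subst2 a u v)"
  by (rule ncseries_eqI) (simp add: coeff_subst2 coeff_simps sum_distrib_left mult.assoc)

lemma subst2_zero: "subst2 0 u v = 0"
  by (rule ncseries_eqI) (simp add: coeff_subst2 coeff_simps)

lemma subst2_one: "subst2 1 u v = 1"
proof (rule ncseries_eqI)
  fix w
  have "coeff (subst2 1 u v) w
      = (\<Sum>m | length m \<le> length w. if m = [] then coeff (word_subst u v m) w else 0)"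
    unfolding coeff_subst2 by (intro sum.cong refl) (simp add: coeff_simps)
  then show "coeff (subst2 1 u v) w = coeff 1 w"
    by (simp add: finite_words word_subst_def)
qed

lemma subst2_var:
  assumes "coeff u [] = 0" "coeff v [] = 0"
  shows "subst2 (var l) u v = (case l of X \<Rightarrow> u | Y \<Rightarrow> v)"
proof (rule ncseries_eqI)
  fix w
  have "coeff (subst2 (var l) u v) w
      = (\<Sum>m | length m \<le> Suc (length w). if m = [l] then coeff (word_subst u v m) w else 0)"
    by (subst coeff_subst2'[OF assms, of _ "Suc (length w)"])
       (auto intro!: sum.cong simp: coeff_simps)
  then show "coeff (subst2 (var l) u v) w = coeff (case l of X \<Rightarrow> u | Y \<Rightarrow> v) w"
    by (simp add: finite_words word_subst_def)
qed

lemma subst2_mult: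
  fixes u v :: "('v, 'k::comm_ring_1) ncseries"
  assumes uv: "coeff u [] = 0" "coeff v [] = 0"
  shows "subst2 (a * b) u v = subst2 a u v * subst2 b u v"
proof (rule ncseries_eqI)
  fix w :: "'v list"
  let ?N = "length w"
  let ?W = "{m :: letter list. length m \<le> ?N}"
  let ?s = "\<lambda>m m'. coeff a m * coeff b m' * coeff (word_subst u v (m @ m')) w"
  have "coeff (subst2 (a * b) u v) w
      = (\<Sum>m\<in>?W. \<Sum>i\<le>length m. ?s (take i m) (drop i m))"
    unfolding coeff_subst2 coeff_mult by (simp add: sum_distrib_right)
  also have "\<dots> = (\<Sum>(m, m')\<in>{(m, m'). length m + length m' \<le> ?N}. ?s m m')"
    unfolding sum.Sigma[OF finite_words ballI[OF finite_atMost]]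
    by (rule sum.reindex_bij_witness[where i = "\<lambda>(m, m'). (m @ m', length m)"
          and j = "\<lambda>(m, i). (take i m, drop i m)"]) auto
  also have "\<dots> = (\<Sum>(m, m')\<in>?W \<times> ?W. ?s m m')"
  proof (intro sum.mono_neutral_left finite_cartesian_product finite_words)
    have "?s m m' = 0" if "\<not> length m + length m' \<le> ?N" for m m'
      using that by (simp add: coeff_word_subst_eq_0[OF uv])
    then show "\<forall>p\<in>?W \<times> ?W - {(m, m'). length m + length m' \<le> ?N}. (case p of (m, m') \<Rightarrow> ?s m m') = 0"
      by fast
  qed auto
  also have "\<dots> = (\<Sum>m\<in>?W. \<Sum>m'\<in>?W. \<Sum>i\<le>?N. (coeff a m * coeff (word_subst u v m) (take i w)) *
      (coeff b m' * coeff (word_subst u v m') (drop i w)))"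
    unfolding sum.cartesian_product[symmetric] word_subst_append coeff_mult
    by (simp add: sum_distrib_left mult_ac)
  also have "\<dots> = (\<Sum>m\<in>?W. \<Sum>i\<le>?N. \<Sum>m'\<in>?W. (coeff a m * coeff (word_subst u v m) (take i w)) *
      (coeff b m' * coeff (word_subst u v m') (drop i w)))"
    by (intro sum.cong refl sum.swap)
  also have "\<dots> = (\<Sum>i\<le>?N. \<Sum>m\<in>?W. \<Sum>m'\<in>?W. (coeff a m * coeff (word_subst u v m) (take i w)) *
      (coeff b m' * coeff (word_subst u v m') (drop i w)))"
    by (rule sum.swap)
  also have "\<dots> = (\<Sum>i\<le>?N. coeff (subst2 a u v) (take i w) * coeff (subst2 b u v) (drop i w))"
    by (intro sum.cong refl) (simp add: coeff_subst2'[OF uv, where N = ?N] sum_product)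
  finally show "coeff (subst2 (a * b) u v) w = coeff (subst2 a u v * subst2 b u v) w"
    by (simp add: coeff_mult)
qed


section \<open>The Lie algebras \<open>t_n\<close>\<close>

text \<open>The letter of the generator with indices \<open>i\<close>, \<open>j\<close> is the unordered pair \<open>{i, j}\<close>.\<close>

definition t_letters :: "nat \<Rightarrow> nat set set"
  where "t_letters n = {{i, j} | i j. i \<in> {1..n} \<and> j \<in> {1..n} \<and> i \<noteq> j}"

definition t :: "nat \<Rightarrow> nat \<Rightarrow> (nat set, 'k::comm_ring_1) ncseries"
  where "t i j = var {i, j}"

definition t_relators :: "nat \<Rightarrow> (nat set, 'k::field) ncseries set"
  where "t_relators n =
    {bracket (t i j) (t k l) | i j k l. {i, j, k, l} \<subseteq> {1..n} \<and> distinct [i, j, k, l]} \<union>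
    {bracket (t i j + t i k) (t j k) | i j k. {i, j, k} \<subseteq> {1..n} \<and> distinct [i, j, k]}"

text \<open>The Lie ideal of the free Lie algebra generated by the relators.\<close>

inductive_set t_ideal :: "nat \<Rightarrow> (nat set, 'k::field) ncseries set" for n where
  zero: "0 \<in> t_ideal n"
| relator: "r \<in> t_relators n \<Longrightarrow> r \<in> t_ideal n"
| add: "a \<in> t_ideal n \<Longrightarrow> b \<in> t_ideal n \<Longrightarrow> a + b \<in> t_ideal n"
| scale: "a \<in> t_ideal n \<Longrightarrow> scale c a \<in> t_ideal n"
| bracket: "a \<in> t_ideal n \<Longrightarrow> b \<in> free_lie (t_letters n) \<Longrightarrow> bracket b a \<in> t_ideal n"

text \<open>
  The class in the degree-completed \<open>t_n\<close> of an element of the degree-completed free Lie algebra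
  on \<open>t_letters n\<close>. The ideal is graded, so the completion of the quotient is the
  quotient of the completions.
\<close>

definition t_class :: "nat \<Rightarrow> (nat set, 'k::field) ncseries \<Rightarrow> (nat set, 'k) ncseries set"
  where "t_class n a = a +o degree_completion (t_ideal n)"

text \<open>
  \<open>\<psi>(u, v)\<close> in \<open>t_n\<close>, for the images in \<open>t_n\<close> of \<open>u\<close> and \<open>v\<close>: the homomorphism
  from the free Lie algebra to the quotient factors through the substitution upstairs.
\<close>

definition t_subst :: "nat \<Rightarrow> 'k::field assoc2 \<Rightarrow> (nat set, 'k) ncseries \<Rightarrow> (nat set, 'k) ncseries
    \<Rightarrow> (nat set, 'k) ncseries set"
  where "t_subst n \<psi> u v = t_class n (subst2 \<psi> u v)"


section \<open>The Grothendieck--Teichmueller Lie algebra\<close>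

definition grt :: "'k::field assoc2 set"
  where "grt = {\<psi> \<in> lie2.
    (let x = var X; y = var Y; z = - x - y in
      \<psi> = - subst2 \<psi> y x \<and>
      \<psi> + subst2 \<psi> y z + subst2 \<psi> z x = 0) \<and>
    t_subst 4 \<psi> (t 1 2) (t 2 3 + t 2 4) + t_subst 4 \<psi> (t 1 3 + t 2 3) (t 3 4) =
      t_subst 4 \<psi> (t 2 3) (t 3 4) + t_subst 4 \<psi> (t 1 2 + t 1 3) (t 2 4 + t 3 4)
        + t_subst 4 \<psi> (t 1 2) (t 2 3)}"

lemma subspace_degree_completion:
  fixes V :: "('v, 'k::field) ncseries set"
  assumes "ncseries.subspace V"
  shows "ncseries.subspace (degree_completion V)"
proof -
  have "homog_part d (0 :: ('v, 'k) ncseries) = 0" "homog_part d (a + b) = homog_part d a + homog_part d b"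
    "homog_part d (scale c a) = scale c (homog_part d a)" for d c and a b :: "('v, 'k) ncseries"
    by (transfer; auto)+
  then show ?thesis
    using assms by (auto simp: ncseries.subspace_def degree_completion_def)
qed

lemma subspace_lie2: "ncseries.subspace lie2"
  unfolding lie2_def
  by (intro subspace_degree_completion)
     (auto simp: ncseries.subspace_def intro: free_lie.zero free_lie.add free_lie.scale)

lemma subspace_t: "ncseries.subspace (degree_completion (t_ideal n))"
  by (intro subspace_degree_completion)
     (auto simp: ncseries.subspace_def intro: t_ideal.zero t_ideal.add t_ideal.scale)

lemma coset_eq_iff:
  assumes "ncseries.subspace W"
  shows "a +o W = b +o W \<longleftrightarrow> a - b \<in> W"
proof
  assume "a +o W = b +o W"
  moreover have "a \<in> a +o W"
    using ncseries.subspace_0[OF assms] by (force simp: elt_set_plus_def)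
  ultimately show "a - b \<in> W" by (auto simp: elt_set_plus_def)
next
  assume d: "a - b \<in> W"
  have "a + w = b + ((a - b) + w)" "b + w = a + (w - (a - b))" for w
    by (simp_all add: algebra_simps)
  then show "a +o W = b +o W"
    using ncseries.subspace_add[OF assms d] ncseries.subspace_diff[OF assms _ d]
    unfolding elt_set_plus_def by blast
qed

lemma t_class_add:
  fixes a b :: "(nat set, 'k::field) ncseries"
  shows "t_class n a + t_class n b = t_class n (a + b)"
proof -
  let ?W = "degree_completion (t_ideal n) :: (nat set, 'k) ncseries set"
  have "?W + ?W = ?W"
  proof
    show "?W + ?W \<subseteq> ?W"
      using ncseries.subspace_add[OF subspace_t] by (auto simp: set_plus_def)
    show "?W \<subseteq> ?W + ?W"
      using ncseries.subspace_0[OF subspace_t] by (force simp: set_plus_def)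
  qed
  then show ?thesis
    by (simp add: t_class_def set_plus_rearrange)
qed

text \<open>The solutions of the defining equations already form a subspace, so no span is needed.\<close>

lemma subspace_grt: "ncseries.subspace (grt :: 'k::field assoc2 set)"
proof -
  define x y z :: "'k assoc2" where "x = var X" and "y = var Y" and "z = - x - y"
  define P where "P \<psi> = \<psi> + subst2 \<psi> y x" for \<psi> :: "'k assoc2"
  define Q where "Q \<psi> = \<psi> + subst2 \<psi> y z + subst2 \<psi> z x" for \<psi> :: "'k assoc2"
  define R where "R \<psi> = subst2 \<psi> (t 1 2) (t 2 3 + t 2 4) + subst2 \<psi> (t 1 3 + t 2 3) (t 3 4)
    - (subst2 \<psi> (t 2 3) (t 3 4) + subst2 \<psi> (t 1 2 + t 1 3) (t 2 4 + t 3 4)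
        + subst2 \<psi> (t 1 2) (t 2 3))" for \<psi> :: "'k assoc2"
  have grt: "\<psi> \<in> grt \<longleftrightarrow>
      \<psi> \<in> lie2 \<and> P \<psi> = 0 \<and> Q \<psi> = 0 \<and> R \<psi> \<in> degree_completion (t_ideal 4)" for \<psi>
    unfolding grt_def P_def Q_def R_def x_def y_def z_def
    by (simp add: Let_def t_subst_def t_class_add eq_neg_iff_add_eq_0)
       (simp add: t_class_def coset_eq_iff[OF subspace_t])
  have "P 0 = 0" "Q 0 = 0" "R 0 = 0"
    by (simp_all add: P_def Q_def R_def subst2_zero)
  moreover have "P (a + b) = P a + P b" "Q (a + b) = Q a + Q b" "R (a + b) = R a + R b" for a b
    by (simp_all add: P_def Q_def R_def subst2_add)
  moreover have "P (scale c a) = scale c (P a)" "Q (scale c a) = scale c (Q a)"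
      "R (scale c a) = scale c (R a)" for c a
    by (simp_all add: P_def Q_def R_def subst2_scale ncseries.scale_right_distrib
          ncseries.scale_right_diff_distrib)
  ultimately show ?thesis
    using subspace_lie2 subspace_t[of 4]
    by (auto simp: ncseries.subspace_def grt)
qed

end

theory Submission
  imports Defs
begin

text \<open>
  The two sides of the first equation, of the trace equation and of the hexagon differ,
  over a field where 2 is invertible, by a multiple of 3; this is why \<open>-[x, y]\<close> is a solution in
  characteristic 3 (\<open>triple_eq_0\<close>). The first equation holds because
  \<open>[y, [x, y]] - [x, [x, y]]\<close> has the coefficients \<open>-1, 2, -1\<close> on the words in each
  bidegree, and \<open>2 = -1\<close>. The two sides of the trace equation are represented by
  \<open>xy + yx\<close> and \<open>-(xy + yx)/2\<close>, which differ by \<open>3(xy + yx)/2\<close>, so they agree before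
  commutators are divided out. The hexagon sum is three times \<open>\<psi>\<close>, by
  \<open>[y, z] = [z, x] = [x, y]\<close> for \<open>x + y + z = 0\<close>.

  The pentagon holds for a different reason (\<open>pentagon_neg_bracket\<close>): after
  bilinear expansion the sides differ by \<open>[t 1 2, t 3 4] + [t 1 3, t 2 4]\<close>, a sum of two relators.
\<close>

lemma triple_eq_0:
  fixes a :: "('v, 'k::field) ncseries"
  assumes "CHAR('k) = 3"
  shows "a + a + a = 0"
proof (rule ncseries_eqI)
  fix w
  have three: "(3::'k) = 0"
    using of_nat_CHAR[where 'a = 'k] assms by simp
  have "coeff (a + a + a) w = 3 * coeff a w" by (simp add: coeff_simps)
  then show "coeff (a + a + a) w = coeff 0 w" by (simp add: three coeff_simps)
qed

lemma bracket_add_left: "bracket (a + b) c = bracket a c + bracket b c"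
  and bracket_add_right: "bracket a (b + c) = bracket a b + bracket a c"
  by (simp_all add: bracket_def algebra_simps)

lemma coeff_homog_part: "coeff (homog_part d a) w = (if length w = d then coeff a w else 0)"
  by transfer simp

lemma coeff_var_mult_var:
  "coeff (var a * var b :: ('v, 'k::comm_ring_1) ncseries) w = (if w = [a, b] then 1 else 0)"
proof -
  have "(if take i w = [a] then 1 else 0) * (if drop i w = [b] then 1 else (0::'k))
      = (if i = 1 then if w = [a, b] then 1 else 0 else 0)" if "i \<le> length w" for i
  proof -
    have "take i w = [a] \<and> drop i w = [b] \<longleftrightarrow> i = 1 \<and> w = [a, b]"
    proof
      assume h: "take i w = [a] \<and> drop i w = [b]"
      then have "w = [a] @ [b]" by (metis append_take_drop_id)
      moreover have "length (take i w) = 1" using h by simp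
      ultimately show "i = 1 \<and> w = [a, b]" using that by simp
    qed auto
    then show ?thesis by auto
  qed
  then have "coeff (var a * var b :: ('v, 'k) ncseries) w
      = (\<Sum>i\<le>length w. if i = 1 then if w = [a, b] then 1 else 0 else 0)"
    unfolding coeff_mult coeff_simps by (intro sum.cong refl) simp
  then show ?thesis by auto
qed

lemma homog_part_bracket_var:
  "homog_part d (bracket (var a) (var b)) = (if d = 2 then bracket (var a) (var b) else 0)"
  by (rule ncseries_eqI)
     (auto simp: coeff_homog_part bracket_def coeff_simps coeff_var_mult_var)

text \<open>
  A bracket of two letters is homogeneous, so its only nonzero component is itself. All
  elements that have to be placed in \<open>lie2\<close> or in the completed ideal of \<open>t_n\<close> are
  linear combinations of such brackets.
\<close>

lemma bracket_var_in_degree_completion: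
  assumes "bracket (var a) (var b) \<in> V" "0 \<in> V"
  shows "bracket (var a) (var b) \<in> degree_completion V"
  using assms by (simp add: degree_completion_def homog_part_bracket_var)

lemma bracket_in_lie2: "bracket (var a) (var b) \<in> lie2"
  unfolding lie2_def
  by (intro bracket_var_in_degree_completion free_lie.intros UNIV_I)

lemma partial_X_eq:
  assumes "a = scale c 1 + a1 * var X + a2 * var Y"
  shows "partial_X a = a1"
  unfolding partial_X_def using right_decomposition[of a] assms
  by (intro the_equality) auto

lemma partial_Y_eq:
  assumes "a = scale c 1 + a1 * var X + a2 * var Y"
  shows "partial_Y a = a2"
  unfolding partial_Y_def using right_decomposition[of a] assms
  by (intro the_equality) auto

lemma coset_scale_coset:
  assumes "ncseries.subspace W"
  shows "coset_scale W c (a +o W) = scale c a +o W"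
proof
  show "coset_scale W c (a +o W) \<subseteq> scale c a +o W"
    using ncseries.subspace_add[OF assms] ncseries.subspace_scale[OF assms]
    by (auto simp: coset_scale_def elt_set_plus_def set_plus_def
        ncseries.scale_right_distrib add.assoc)
next
  have "a \<in> a +o W"
    using ncseries.subspace_0[OF assms] by (force simp: elt_set_plus_def)
  then have "scale c a \<in> scale c ` (a +o W)" by (rule imageI)
  then show "scale c a +o W \<subseteq> coset_scale W c (a +o W)"
    unfolding coset_scale_def by (auto simp: elt_set_plus_def intro: set_plus_intro)
qed

lemma tr_scale_tr: "tr_scale c (tr a) = tr (scale c a)"
  by (simp add: tr_scale_def tr_def commutator_span_def coset_scale_coset ncseries.subspace_span)

lemma subst2_neg_bracket_var:
  assumes "coeff u [] = 0" "coeff v [] = 0"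
  shows "subst2 (- bracket (var X) (var Y)) u v = - bracket u v"
proof -
  have eq: "- bracket (var X) (var Y)
      = scale (- 1) (var X * var Y) + var Y * (var X :: 'a assoc2)"
    by (rule ncseries_eqI) (simp add: bracket_def coeff_simps)
  have "scale (- 1) (u * v) + v * u = - bracket u v"
    by (rule ncseries_eqI) (simp add: bracket_def coeff_simps)
  then show ?thesis
    by (simp add: eq subst2_add subst2_scale subst2_mult subst2_var assms)
qed

lemma bracket_t_in_t_ideal:
  assumes "{i, j, k, l} \<subseteq> {1..n}" "distinct [i, j, k, l]"
  shows "bracket (t i j) (t k l) \<in> degree_completion (t_ideal n)"
  unfolding t_def
proof (rule bracket_var_in_degree_completion)
  show "bracket (var {i, j}) (var {k, l}) \<in> t_ideal n"
    using assms by (intro t_ideal.relator) (auto simp: t_relators_def t_def)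
qed (rule t_ideal.zero)

text \<open>
  Bilinearity cancels every term of the pentagon that involves two overlapping index pairs. The
  brackets of disjoint pairs that remain are relators of \<open>t_4\<close>.
\<close>

lemma pentagon_neg_bracket:
  fixes \<psi> :: "'k::field assoc2"
  assumes "\<psi> = - bracket (var X) (var Y)"
  shows "t_subst 4 \<psi> (t 1 2) (t 2 3 + t 2 4) + t_subst 4 \<psi> (t 1 3 + t 2 3) (t 3 4) =
      t_subst 4 \<psi> (t 2 3) (t 3 4) + t_subst 4 \<psi> (t 1 2 + t 1 3) (t 2 4 + t 3 4)
        + t_subst 4 \<psi> (t 1 2) (t 2 3)"
proof -
  have c: "coeff (t i j :: (nat set, 'k) ncseries) [] = 0" for i j
    by (simp add: t_def coeff_simps)
  let ?b = "bracket :: (nat set, 'k) ncseries \<Rightarrow> _"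
  have "?b (t 1 2) (t 3 4) + ?b (t 1 3) (t 2 4) \<in> degree_completion (t_ideal 4)"
    by (intro ncseries.subspace_add[OF subspace_t] bracket_t_in_t_ideal) auto
  moreover have "- ?b (t 1 2) (t 2 3 + t 2 4) + - ?b (t 1 3 + t 2 3) (t 3 4)
      - (- ?b (t 2 3) (t 3 4) + - ?b (t 1 2 + t 1 3) (t 2 4 + t 3 4) + - ?b (t 1 2) (t 2 3))
      = ?b (t 1 2) (t 3 4) + ?b (t 1 3) (t 2 4)"
    by (simp add: bracket_add_left bracket_add_right)
  ultimately show ?thesis
    unfolding t_subst_def t_class_add assms
    by (simp add: subst2_neg_bracket_var c coeff_simps t_class_def coset_eq_iff[OF subspace_t])
qed

theorem mainTheorem2:
  fixes x y A B \<psi> :: "'k::field assoc2"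
  assumes "CHAR('k) = 3"
    and "x = var X" and "y = var Y"
    and "A = - bracket x y" and "B = bracket x y" and "\<psi> = - bracket x y"
  shows "A \<in> lie2 \<and> B \<in> lie2 \<and>
    bracket x A + bracket y B = x ^ 3 + y ^ 3 - (x + y) ^ 3 \<and>
    tr (x * partial_X A + y * partial_Y B) = tr_scale (1 / 2) (tr (x ^ 2 + y ^ 2 - (x + y) ^ 2)) \<and>
    subst2 \<psi> (- x - y) x = A \<and> subst2 \<psi> (- x - y) y = B \<and>
    \<psi> \<in> grt"
proof -
  note [simp] = assms(2-6)
  have c0: "coeff x [] = 0" "coeff y [] = 0" "coeff (- x - y) [] = 0"
    by (simp_all add: coeff_simps)
  have subst: "subst2 \<psi> u v = - bracket u v"
    if "coeff u [] = 0" "coeff v [] = 0" for u v :: "'k assoc2"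
    using subst2_neg_bracket_var[OF that] by simp
  have B: "B \<in> lie2" by (simp add: bracket_in_lie2)
  then have A: "A \<in> lie2"
    using ncseries.subspace_neg[OF subspace_lie2] by simp

  have cubes: "bracket x A + bracket y B = x ^ 3 + y ^ 3 - (x + y) ^ 3"
  proof -
    \<comment> \<open>Over any field the two sides differ by 3 times the sum of the middle words of
      the two bidegrees.\<close>
    have "bracket x A + bracket y B - (x ^ 3 + y ^ 3 - (x + y) ^ 3)
        = (x * y * x + y * x * y) + (x * y * x + y * x * y) + (x * y * x + y * x * y)"
      by (simp only: assms(4,5)) (simp add: bracket_def power3_eq_cube algebra_simps del: assms(2,3))
    then show ?thesis using triple_eq_0[OF assms(1)] by (metis eq_iff_diff_eq_0)
  qed

  have trace: "tr (x * partial_X A + y * partial_Y B)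
      = tr_scale (1 / 2) (tr (x ^ 2 + y ^ 2 - (x + y) ^ 2))"
  proof -
    have "partial_X A = y"
      by (rule partial_X_eq[where c = 0 and ?a2.0 = "- x"]) (simp add: bracket_def)
    moreover have "partial_Y B = x"
      by (rule partial_Y_eq[where c = 0 and ?a1.0 = "- y"]) (simp add: bracket_def)
    moreover have half: "(1 / 2 :: 'k) = - 1"
    proof -
      have three: "(3::'k) = 0"
        using of_nat_CHAR[where 'a = 'k] assms(1) by simp
      have two: "(2::'k) = 3 - 1" by simp
      show ?thesis unfolding two three by simp
    qed
    moreover have "scale (- 1) (x ^ 2 + y ^ 2 - (x + y) ^ 2) = x * y + y * x"
      by (simp add: power2_eq_square algebra_simps del: assms(2,3))
    ultimately show ?thesis by (simp only: tr_scale_tr)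
  qed

  have substA: "subst2 \<psi> (- x - y) x = A"
    unfolding subst[OF c0(3,1)] assms(4) by (simp add: bracket_def algebra_simps del: assms(2,3))
  have substB: "subst2 \<psi> (- x - y) y = B"
    unfolding subst[OF c0(3,2)] assms(5) by (simp add: bracket_def algebra_simps del: assms(2,3))

  have "\<psi> = - subst2 \<psi> y x"
    unfolding subst[OF c0(2,1)] unfolding assms(6) by (simp add: bracket_def del: assms(2,3))
  moreover have "\<psi> + subst2 \<psi> y (- x - y) + subst2 \<psi> (- x - y) x = 0"
  proof -
    have "subst2 \<psi> y (- x - y) = \<psi>"
      unfolding subst[OF c0(2,3)] unfolding assms(6)
      by (simp add: bracket_def algebra_simps del: assms(2,3))
    moreover have "subst2 \<psi> (- x - y) x = \<psi>"
      using substA by simp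
    ultimately show ?thesis by (simp only: triple_eq_0[OF assms(1)])
  qed
  moreover have "\<psi> \<in> lie2" using A by simp
  ultimately have "\<psi> \<in> grt"
    using pentagon_neg_bracket[of \<psi>] assms(2,3,6)
    by (simp only: grt_def Let_def mem_Collect_eq)
  then show ?thesis using A B cubes trace substA substB by blast
qed

end
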